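(* Let $M\in\mathbb{R}^{2n\times 2n}$ be symmetric positive-definite with symplectic eigenvalues $d_1\le\dots\le d_n$ and let $1\le k\le n$. Consider the problem $\min_{X\in\mathbb{R}^{2n\times 2k}} f(X):=\mathrm{tr}(X^TMX)$ subject to $X^TJ_{2n}X=J_{2k}$. (i) If $X_*\in\mathrm{Sp}(2k,2n)$ is a global minimizer of this problem, then for any $K\in\mathrm{OrSp}(2k)$ the matrix $X_*K$ is also a global minimizer of this problem. (ii) A matrix $X_*\in\mathrm{Sp}(2k,2n)$ is a global minimizer of this problem if and only if there exists $K\in\mathrm{OrSp}(2k)$ such that the columns of $X_*K$ form a normalized symplectic eigenvector set of $M$ associated with the symplectic eigenvalues $d_1,\dots,d_k$.
   Context: Let $J_{2n}=\begin{bmatrix}0&I_n\\-I_n&0\end{bmatrix}$. $\mathrm{Sp}(2k,2n)=\{X\in\mathbb{R}^{2n\times 2k}: X^TJ_{2n}X=J_{2k}\}$, $\mathrm{Sp}(2k)=\mathrm{Sp}(2k,2k)$, and $\mathrm{OrSp}(2k)$ is the set of matrices in $\mathrm{Sp}(2k)$ that are also orthogonal. Symplectic eigenvalues: by Williamson's theorem there is $S\in\mathrm{Sp}(2n)$ with $S^TMS=\mathrm{diag}(D,D)$, $D=\mathrm{diag}(d_1,\dots,d_n)$, $0<d_1\le\dots\le d_n$; the $d_i$ (uniquely determined by $M$) are the symplectic eigenvalues of $M$, listed with multiplicity in non-decreasing order. Normalized symplectic eigenvector set: the columns of $X\in\mathbb{R}^{2n\times 2k}$ form a normalized symplectic eigenvector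 set of $M$ associated with the symplectic eigenvalues $\lambda_1,\dots,\lambda_k$ if $X\in\mathrm{Sp}(2k,2n)$ and $MX=J_{2n}X\begin{bmatrix}0&-\Lambda\\\Lambda&0\end{bmatrix}$ with $\Lambda=\mathrm{diag}(\lambda_1,\dots,\lambda_k)$. *)

theory Defs
  imports "Jordan_Normal_Form.Matrix"
begin

text \<open>Families such as \<open>d\<^sub>1, \<dots>, d\<^sub>n\<close> are functions \<open>nat \<Rightarrow> real\<close> indexed from 0; only the
  values below the stated length are relevant.\<close>

definition mat_trace :: "real mat \<Rightarrow> real" where
  "mat_trace A = (\<Sum>i<dim_row A. A $$ (i, i))"

definition positive_definite_mat :: "nat \<Rightarrow> real mat \<Rightarrow> bool" where
  "positive_definite_mat m A \<longleftrightarrow>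
     A \<in> carrier_mat m m \<and> (\<forall>v \<in> carrier_vec m. v \<noteq> 0\<^sub>v m \<longrightarrow> v \<bullet> (A *\<^sub>v v) > 0)"

text \<open>The argument is half the size: \<open>J_mat n\<close> is the \<open>2n \<times> 2n\<close> Poisson matrix
  \<open>J\<^bsub>2n\<^esub>\<close>. Likewise \<open>Sp k n\<close> is \<open>Sp(2k,2n)\<close> and \<open>OrSp k\<close> is \<open>OrSp(2k)\<close>.\<close>

definition J_mat :: "nat \<Rightarrow> real mat" where
  "J_mat n = four_block_mat (0\<^sub>m n n) (1\<^sub>m n) (- 1\<^sub>m n) (0\<^sub>m n n)"

definition Sp :: "nat \<Rightarrow> nat \<Rightarrow> real mat set" where
  "Sp k n = {X \<in> carrier_mat (2 * n) (2 * k). X\<^sup>T * J_mat n * X = J_mat k}"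

definition OrSp :: "nat \<Rightarrow> real mat set" where
  "OrSp k = {K \<in> Sp k k. K\<^sup>T * K = 1\<^sub>m (2 * k)}"

definition symplectic_eigenvalues :: "nat \<Rightarrow> real mat \<Rightarrow> (nat \<Rightarrow> real) \<Rightarrow> bool" where
  "symplectic_eigenvalues n M d \<longleftrightarrow>
     (\<forall>i<n. 0 < d i) \<and> (\<forall>i j. i \<le> j \<and> j < n \<longrightarrow> d i \<le> d j) \<and>
     (\<exists>S \<in> Sp n n. S\<^sup>T * M * S =
        four_block_mat (mat_diag n d) (0\<^sub>m n n) (0\<^sub>m n n) (mat_diag n d))"

definition normalized_symplectic_eigenvector_set ::
    "nat \<Rightarrow> nat \<Rightarrow> real mat \<Rightarrow> (nat \<Rightarrow> real) \<Rightarrow> real mat \<Rightarrow> bool" where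
  "normalized_symplectic_eigenvector_set k n M l X \<longleftrightarrow>
     X \<in> Sp k n \<and>
     M * X = J_mat n * X *
       four_block_mat (0\<^sub>m k k) (- mat_diag k l) (mat_diag k l) (0\<^sub>m k k)"

definition global_minimizer :: "nat \<Rightarrow> nat \<Rightarrow> real mat \<Rightarrow> real mat \<Rightarrow> bool" where
  "global_minimizer k n M X \<longleftrightarrow>
     is_arg_min (\<lambda>Y. mat_trace (Y\<^sup>T * M * Y)) (\<lambda>Y. Y \<in> Sp k n) X"

end

theory Submission
  imports Defs "Jordan_Normal_Form.Determinant"
begin

text \<open>Williamson's theorem lets us replace \<open>M\<close> by \<open>diag(D, D)\<close>. Split \<open>Y \<in> Sp(2k, 2n)\<close> as \<open>P + Q\<close> with
  \<open>J P = P J\<close> and \<open>J Q = - Q J\<close>; the constraint gives \<open>P\<^sup>T P = I + Q\<^sup>T Q\<close>, and the objective is the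
  sum of those of \<open>P\<close> and \<open>Q\<close>. Since \<open>P\<^sup>T P \<ge> I\<close>, the Gram matrix \<open>P P\<^sup>T\<close> dominates the
  projection onto the range of \<open>P\<close>, whose diagonal entries lie in \<open>[0, 1]\<close> and sum to \<open>2k\<close>. Hence the
  objective is at least \<open>2 (d\<^sub>1 + \<dots> + d\<^sub>k)\<close>. Equality forces \<open>Q = 0\<close>, so that \<open>Y\<close> has orthonormal
  columns and commutes with \<open>J\<close>, and it fixes the diagonal of \<open>Y Y\<^sup>T\<close> at all indices with
  \<open>d\<^sub>i \<noteq> d\<^sub>k\<close>: it is 1 where \<open>d\<^sub>i < d\<^sub>k\<close> and 0 where \<open>d\<^sub>i > d\<^sub>k\<close>. The rows of \<open>Y\<close> with \<open>d\<^sub>i < d\<^sub>k\<close> are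
  therefore the first columns of a matrix \<open>K\<close> in \<open>OrSp(2k)\<close>, and any completion works because the
  remaining columns of \<open>Y K\<close> are supported where \<open>d\<^sub>i = d\<^sub>k\<close>.\<close>

section \<open>Matrix algebra under dimension equations, and the trace\<close>

lemma mult_assoc_dim:
  "dim_col A = dim_row B \<Longrightarrow> dim_col B = dim_row C \<Longrightarrow> (A * B) * C = A * (B * (C :: real mat))"
  by (rule assoc_mult_mat) auto

lemma transpose_mult_dim:
  "dim_col A = dim_row B \<Longrightarrow> (A * B)\<^sup>T = B\<^sup>T * (A :: real mat)\<^sup>T"
  by (rule transpose_mult) auto

lemma minus_mult_left_dim:
  "dim_col A = dim_row B \<Longrightarrow> (- A) * B = - (A * (B :: real mat))"
  by (rule eq_matI) (auto simp: scalar_prod_def sum_negf)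

lemma minus_mult_right_dim:
  "dim_col A = dim_row B \<Longrightarrow> A * (- B) = - (A * (B :: real mat))"
  by (rule eq_matI) (auto simp: scalar_prod_def sum_negf)

lemma one_mult_dim [simp]: "dim_row A = n \<Longrightarrow> 1\<^sub>m n * A = (A :: real mat)"
  by (rule left_mult_one_mat) auto

lemma mult_one_dim [simp]: "dim_col A = n \<Longrightarrow> A * 1\<^sub>m n = (A :: real mat)"
  by (rule right_mult_one_mat) auto

lemma transpose_minus: "(- A)\<^sup>T = - (A :: real mat)\<^sup>T"
  by (rule eq_matI) auto

lemma index_mult_mat_sum:
  fixes A B :: "real mat"
  assumes "i < dim_row A" "j < dim_col B" "dim_col A = dim_row B"
  shows "(A * B) $$ (i, j) = (\<Sum>l<dim_row B. A $$ (i, l) * B $$ (l, j))"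
  using assms by (auto simp: scalar_prod_def atLeast0LessThan)

lemma index_mult_transpose:
  fixes A B :: "real mat"
  assumes "i < dim_row A" "j < dim_row B" "dim_col A = dim_col B"
  shows "(A * B\<^sup>T) $$ (i, j) = row A i \<bullet> row B j"
  using assms by simp

lemma mat_trace_comm:
  assumes "dim_row A = dim_col B" "dim_col A = dim_row B"
  shows "mat_trace (A * B) = mat_trace (B * A)"
proof -
  have "mat_trace (A * B) = (\<Sum>i<dim_row A. \<Sum>l<dim_row B. A $$ (i, l) * B $$ (l, i))"
    unfolding mat_trace_def using assms by (simp add: index_mult_mat_sum del: index_mult_mat(1))
  also have "\<dots> = (\<Sum>l<dim_row B. \<Sum>i<dim_row A. B $$ (l, i) * A $$ (i, l))"
    by (subst sum.swap) (simp add: mult.commute)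
  also have "\<dots> = mat_trace (B * A)"
    unfolding mat_trace_def using assms by (simp add: index_mult_mat_sum del: index_mult_mat(1))
  finally show ?thesis .
qed

lemma mat_trace_one: "mat_trace (1\<^sub>m n) = real n"
  by (simp add: mat_trace_def)

subsection \<open>The Poisson matrix\<close>

lemma J_mat_dim [simp]: "dim_row (J_mat n) = 2 * n" "dim_col (J_mat n) = 2 * n"
  by (simp_all add: J_mat_def)

lemma J_mat_carrier [simp]: "J_mat n \<in> carrier_mat (2 * n) (2 * n)"
  by (rule carrier_matI) simp_all

lemma J_mat_index:
  assumes "i < 2 * n" "j < 2 * n"
  shows "J_mat n $$ (i, j) = (if j = i + n then 1 else if i = j + n then -1 else 0)"
  using assms by (auto simp: J_mat_def)

lemma J_mult_index:
  assumes "i < 2 * n" "j < dim_col A" "dim_row A = 2 * n"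
  shows "(J_mat n * A) $$ (i, j) = (if i < n then A $$ (i + n, j) else - A $$ (i - n, j))"
proof -
  have "(J_mat n * A) $$ (i, j) = (\<Sum>l<2*n. J_mat n $$ (i, l) * A $$ (l, j))"
    using assms by (subst index_mult_mat_sum) auto
  also have "\<dots> = (\<Sum>l<2*n. if l = (if i < n then i + n else i - n)
      then (if i < n then A $$ (i + n, j) else - A $$ (i - n, j)) else 0)"
    using assms by (intro sum.cong) (auto simp: J_mat_index)
  also have "\<dots> = (if i < n then A $$ (i + n, j) else - A $$ (i - n, j))"
    using assms by (subst sum.delta) auto
  finally show ?thesis .
qed

lemma J_transpose: "(J_mat n)\<^sup>T = - J_mat n"
  by (rule eq_matI) (auto simp: J_mat_index)

lemma J_square: "J_mat n * J_mat n = - 1\<^sub>m (2 * n)"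
proof (rule eq_matI)
  fix i j assume "i < dim_row (- 1\<^sub>m (2 * n) :: real mat)" "j < dim_col (- 1\<^sub>m (2 * n) :: real mat)"
  then show "(J_mat n * J_mat n) $$ (i, j) = (- 1\<^sub>m (2 * n)) $$ (i, j)"
    by (subst J_mult_index) (auto simp: J_mat_index)
qed auto

lemma J_J_mult: "dim_row A = 2 * n \<Longrightarrow> J_mat n * (J_mat n * A) = - A"
  by (subst mult_assoc_dim [symmetric]) (auto simp: J_square minus_mult_left_dim)

text \<open>Transposition reduces this to left multiplication, with the sign from
  \<open>J_transpose\<close>.\<close>

lemma mult_J_index:
  assumes "i < dim_row A" "j < 2 * n" "dim_col A = 2 * n"
  shows "(A * J_mat n) $$ (i, j) = (if j < n then - A $$ (i, j + n) else A $$ (i, j - n))"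
proof -
  have "(A * J_mat n) $$ (i, j) = (A * J_mat n)\<^sup>T $$ (j, i)"
    using assms by simp
  also have "(A * J_mat n)\<^sup>T = - (J_mat n * A\<^sup>T)"
    using assms by (simp add: transpose_mult_dim J_transpose minus_mult_left_dim)
  also have "\<dots> $$ (j, i) = - ((J_mat n * A\<^sup>T) $$ (j, i))"
    using assms by simp
  also have "\<dots> = (if j < n then - A $$ (i, j + n) else A $$ (i, j - n))"
    using assms by (subst J_mult_index) auto
  finally show ?thesis .
qed

lemma J_mult_vec_index:
  assumes "i < 2 * n" "dim_vec v = 2 * n"
  shows "(J_mat n *\<^sub>v v) $ i = (if i < n then v $ (i + n) else - v $ (i - n))"
proof -
  have "(J_mat n *\<^sub>v v) $ i = (J_mat n * mat (2 * n) 1 (\<lambda>(i, j). v $ i)) $$ (i, 0)"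
    using assms by (simp add: scalar_prod_def)
  also have "\<dots> = (if i < n then v $ (i + n) else - v $ (i - n))"
    using assms by (subst J_mult_index) auto
  finally show ?thesis .
qed

lemma J_vec_carrier [simp]: "J_mat n *\<^sub>v v \<in> carrier_vec (2 * n)"
  by (rule carrier_vecI) simp

lemma J_J_vec: "v \<in> carrier_vec (2 * n) \<Longrightarrow> J_mat n *\<^sub>v (J_mat n *\<^sub>v v) = - v"
  by (rule eq_vecI) (auto simp: J_mult_vec_index simp del: index_mult_mat_vec)

lemma J_vec_scalar:
  assumes "v \<in> carrier_vec (2 * n)" "w \<in> carrier_vec (2 * n)"
  shows "(J_mat n *\<^sub>v v) \<bullet> w = - (v \<bullet> (J_mat n *\<^sub>v w))"
proof -
  have "((J_mat n)\<^sup>T *\<^sub>v v) \<bullet> w = v \<bullet> (J_mat n *\<^sub>v w)"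
    using assms by (intro transpose_vec_mult_scalar) auto
  then show ?thesis
    using assms by (simp add: J_transpose)
qed

lemma J_vec_isometry:
  assumes "v \<in> carrier_vec (2 * n)" "w \<in> carrier_vec (2 * n)"
  shows "(J_mat n *\<^sub>v v) \<bullet> (J_mat n *\<^sub>v w) = v \<bullet> w"
  using assms by (simp add: J_vec_scalar J_J_vec)

text \<open>By skewness of J the product equals its own negative.\<close>

lemma J_vec_orthogonal:
  assumes "v \<in> carrier_vec (2 * n)"
  shows "v \<bullet> (J_mat n *\<^sub>v v) = 0"
  using J_vec_scalar [OF assms assms] comm_scalar_prod [of v "2 * n" "J_mat n *\<^sub>v v"] assms by simp

lemma scalar_prod_self_nonneg: "0 \<le> v \<bullet> (v :: real vec)"
  by (auto simp: scalar_prod_def intro: sum_nonneg)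

lemma scalar_prod_self_eq_0:
  assumes "v \<bullet> (v :: real vec) = 0"
  shows "v = 0\<^sub>v (dim_vec v)"
  using assms by (intro eq_vecI) (auto simp: scalar_prod_def sum_nonneg_eq_0_iff)

subsection \<open>Orthogonal projections and the bathtub principle\<close>

lemma projection_diag:
  fixes G :: "real mat"
  assumes "G \<in> carrier_mat N N" "G\<^sup>T = G" "G * G = G" "i < N"
  shows "G $$ (i, i) = (\<Sum>j<N. (G $$ (i, j))\<^sup>2)"
proof -
  have "G $$ (i, i) = (G * G) $$ (i, i)" using assms by simp
  also have "\<dots> = (\<Sum>j<N. G $$ (i, j) * G $$ (j, i))"
    using assms by (subst index_mult_mat_sum) auto
  also have "\<dots> = (\<Sum>j<N. (G $$ (i, j))\<^sup>2)"
  proof (rule sum.cong)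
    fix j assume "j \<in> {..<N}"
    then have "G\<^sup>T $$ (j, i) = G $$ (i, j)" using assms(1,4) by simp
    then show "G $$ (i, j) * G $$ (j, i) = (G $$ (i, j))\<^sup>2"
      using assms(2) by (simp add: power2_eq_square)
  qed simp
  finally show ?thesis .
qed

text \<open>By \<open>projection_diag\<close> a diagonal entry is a sum of squares that includes its
  own square.\<close>

lemma projection_diag_bounds:
  fixes G :: "real mat"
  assumes "G \<in> carrier_mat N N" "G\<^sup>T = G" "G * G = G" "i < N"
  shows "0 \<le> G $$ (i, i)" "G $$ (i, i) \<le> 1"
proof -
  let ?g = "G $$ (i, i)"
  show nn: "0 \<le> ?g"
    by (subst projection_diag [OF assms]) (intro sum_nonneg zero_le_power2)
  have "?g\<^sup>2 \<le> (\<Sum>j<N. (G $$ (i, j))\<^sup>2)"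
    using assms(4) by (intro member_le_sum) auto
  then have "?g * ?g \<le> ?g * 1"
    using projection_diag [OF assms] by (simp add: power2_eq_square)
  then show "?g \<le> 1"
    using nn mult_le_cancel_left_pos [of ?g ?g 1] by linarith
qed

text \<open>The square of the diagonal entry already exhausts the sum in
  \<open>projection_diag\<close>, so nothing is left for the rest of the row.\<close>

lemma projection_diag_one:
  fixes G :: "real mat"
  assumes "G \<in> carrier_mat N N" "G\<^sup>T = G" "G * G = G" "i < N" "G $$ (i, i) = 1"
    and "j < N" "j \<noteq> i"
  shows "G $$ (i, j) = 0"
proof -
  have "1 = (G $$ (i, i))\<^sup>2 + (\<Sum>l\<in>{..<N} - {i}. (G $$ (i, l))\<^sup>2)"
    using projection_diag [OF assms(1-4)] assms(4,5)
    by (simp add: sum.remove [of "{..<N}" i])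
  then have "(\<Sum>l\<in>{..<N} - {i}. (G $$ (i, l))\<^sup>2) = 0"
    using assms(5) by simp
  then show ?thesis
    using assms(6,7) by (subst (asm) sum_nonneg_eq_0_iff) auto
qed

text \<open>\<open>G\<close> is the orthogonal projection onto the range of \<open>P\<close>. By
  \<open>expand\<close> the matrix \<open>P\<^sup>T * P\<close> dominates the identity, so its
  inverse lies below the identity, which bounds the diagonal of \<open>G\<close> by that of
  \<open>P * P\<^sup>T\<close>.\<close>

lemma projection_below_gram:
  fixes P :: "real mat"
  assumes P: "P \<in> carrier_mat N m"
    and expand: "\<And>v. v \<in> carrier_vec m \<Longrightarrow> v \<bullet> v \<le> (P *\<^sub>v v) \<bullet> (P *\<^sub>v v)"
  obtains G where "G \<in> carrier_mat N N" "G\<^sup>T = G" "G * G = G" "mat_trace G = real m"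
    and "\<And>i. i < N \<Longrightarrow> G $$ (i, i) \<le> row P i \<bullet> row P i"
proof -
  define C where "C = P\<^sup>T * P"
  have C: "C \<in> carrier_mat m m" using P by (simp add: C_def)
  have Cv: "(C *\<^sub>v v) \<bullet> v = (P *\<^sub>v v) \<bullet> (P *\<^sub>v v)" if v: "v \<in> carrier_vec m" for v
  proof -
    have "C *\<^sub>v v = P\<^sup>T *\<^sub>v (P *\<^sub>v v)"
      unfolding C_def using P v by (intro assoc_mult_mat_vec) auto
    then show ?thesis
      using transpose_vec_mult_scalar [of P N m v "P *\<^sub>v v"] P v by simp
  qed
  \<comment> \<open>\<open>expand\<close> makes \<open>P\<close> injective, so \<open>C\<close> has
    trivial kernel.\<close>
  have "det C \<noteq> 0"
  proof
    assume "det C = 0"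
    then obtain v where v: "v \<in> carrier_vec m" "v \<noteq> 0\<^sub>v m" "C *\<^sub>v v = 0\<^sub>v m"
      using det_0_iff_vec_prod_zero [OF C] by auto
    have "v \<bullet> v \<le> 0" using expand [OF v(1)] Cv [OF v(1)] v by simp
    then have "v \<bullet> v = 0" using scalar_prod_self_nonneg [of v] by linarith
    then show False using scalar_prod_self_eq_0 [of v] v by (metis carrier_vecD)
  qed
  \<comment> \<open>The argument \<open>()\<close> only fills the extension slot of the record
    \<open>ring_mat\<close>.\<close>
  from det_non_zero_imp_unit [OF C this, of "()"]
  obtain B where B: "B \<in> carrier_mat m m" "B * C = 1\<^sub>m m" "C * B = 1\<^sub>m m"
    unfolding Units_def ring_mat_def by auto
  have dims [simp]: "dim_row P = N" "dim_col P = m" "dim_row B = m" "dim_col B = m"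
      "dim_row C = m" "dim_col C = m"
    using P B C by auto
  have CT: "C\<^sup>T = C" by (simp add: C_def transpose_mult_dim)
  have "B\<^sup>T = B\<^sup>T * (C * B)" using B by simp
  also have "\<dots> = (C * B)\<^sup>T * B"
    by (simp add: transpose_mult_dim CT mult_assoc_dim)
  also have "\<dots> = B" using B by simp
  finally have BT: "B\<^sup>T = B" .
  define G where "G = P * (B * P\<^sup>T)"
  have "G * G = P * (B * (C * (B * P\<^sup>T)))"
    by (simp add: G_def C_def mult_assoc_dim)
  also have "\<dots> = P * ((B * C) * (B * P\<^sup>T))"
    by (simp add: mult_assoc_dim)
  also have "\<dots> = G" by (simp add: B G_def)
  finally have GG: "G * G = G" .
  have "mat_trace G = mat_trace ((B * P\<^sup>T) * P)"
    unfolding G_def by (rule mat_trace_comm) auto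
  also have "(B * P\<^sup>T) * P = 1\<^sub>m m" by (simp add: mult_assoc_dim B flip: C_def)
  finally have trace: "mat_trace G = real m" by (simp add: mat_trace_one)
  have diag: "G $$ (i, i) \<le> row P i \<bullet> row P i" if i: "i < N" for i
  proof -
    define x where "x = row P i"
    \<comment> \<open>\<open>expand\<close> at \<open>y\<close> gives
      \<open>y \<bullet> y \<le> x \<bullet> y\<close>; expanding the square of \<open>x - y\<close>
      then yields \<open>x \<bullet> y \<le> x \<bullet> x\<close>, and \<open>x \<bullet> y\<close>
      is the diagonal entry of \<open>G\<close>.\<close>
    define y where "y = B *\<^sub>v x"
    have x: "x \<in> carrier_vec m" by (intro carrier_vecI) (simp add: x_def)
    have y: "y \<in> carrier_vec m" using B x by (auto simp: y_def)
    have "C *\<^sub>v y = (C * B) *\<^sub>v x" unfolding y_def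
      using B C x by (intro assoc_mult_mat_vec [symmetric]) auto
    then have Cy: "C *\<^sub>v y = x" using x B by simp
    have "G $$ (i, i) = row P i \<bullet> col (B * P\<^sup>T) i"
      using i by (simp add: G_def)
    also have "col (B * P\<^sup>T) i = y"
      using i x unfolding y_def x_def by (intro eq_vecI) auto
    finally have Gii: "G $$ (i, i) = x \<bullet> y" by (simp add: x_def)
    have yy: "y \<bullet> y \<le> x \<bullet> y"
      using expand [OF y] Cv [OF y] Cy by simp
    have "0 \<le> (x - y) \<bullet> (x - y)" by (rule scalar_prod_self_nonneg)
    also have "\<dots> = x \<bullet> x - 2 * (x \<bullet> y) + y \<bullet> y"
      using x y comm_scalar_prod [OF y x]
      by (simp add: scalar_prod_minus_distrib [of _ m] minus_scalar_prod_distrib [of _ m])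
    finally show ?thesis using yy Gii by (simp add: x_def)
  qed
  show thesis
    by (rule that [of G])
      (auto simp: G_def GG [unfolded G_def] trace [unfolded G_def] diag [unfolded G_def]
        transpose_mult_dim BT mult_assoc_dim simp del: index_mult_mat(1))
qed

lemma sum_lessThan_double:
  fixes f :: "nat \<Rightarrow> real"
  shows "(\<Sum>i<2*n. f i) = (\<Sum>i<n. f i + f (i + n))"
proof -
  have "{..<2*n} = {..<n} \<union> {n..<2*n}" by auto
  then have "(\<Sum>i<2*n. f i) = (\<Sum>i<n. f i) + (\<Sum>i\<in>{0+n..<n+n}. f i)"
    by (simp add: sum.union_disjoint ivl_disj_int mult_2 [symmetric])
  also have "(\<Sum>i\<in>{0+n..<n+n}. f i) = (\<Sum>i<n. f (i + n))"
    unfolding sum.shift_bounds_nat_ivl by (simp add: atLeast0LessThan)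
  finally show ?thesis by (simp add: sum.distrib)
qed

text \<open>The comparison is with the filling that puts \<open>b\<close> on the first
  \<open>k\<close> indices. It has the same total as \<open>r\<close>, so lowering every cost by the
  threshold \<open>d (k - 1)\<close> does not change the difference of the two weighted sums, and
  afterwards that difference is nonnegative term by term.\<close>

lemma bathtub:
  fixes d r :: "nat \<Rightarrow> real"
  assumes mono: "mono_on {..<n} d"
    and k: "1 \<le> k" "k \<le> n"
    and r: "\<And>i. i < n \<Longrightarrow> 0 \<le> r i" "\<And>i. i < n \<Longrightarrow> r i \<le> b"
    and total: "(\<Sum>i<n. r i) = b * real k"
  shows "b * (\<Sum>i<k. d i) \<le> (\<Sum>i<n. d i * r i)"
    and "(\<Sum>i<n. d i * r i) = b * (\<Sum>i<k. d i) \<Longrightarrow> i < n \<Longrightarrow> d i < d (k - 1) \<Longrightarrow> r i = b"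
    and "(\<Sum>i<n. d i * r i) = b * (\<Sum>i<k. d i) \<Longrightarrow> i < n \<Longrightarrow> d (k - 1) < d i \<Longrightarrow> r i = 0"
proof -
  \<comment> \<open>Before index \<open>k\<close> both factors are at most 0, from \<open>k\<close>
    on both are at least 0. Counting from 0, \<open>k - 1\<close> is the last index filled.\<close>
  define t where "t i = (d i - d (k - 1)) * (r i - (if i < k then b else 0))" for i
  have t: "0 \<le> t i" if "i < n" for i
  proof (cases "i < k")
    case True
    then have "d i \<le> d (k - 1)" using k by (intro mono_onD [OF mono]) auto
    then show ?thesis using r(2) [OF that] True
      by (auto simp: t_def intro: mult_nonpos_nonpos)
  next
    case False
    then have "d (k - 1) \<le> d i" using that by (intro mono_onD [OF mono]) auto
    then show ?thesis using r(1) [OF that] False by (simp add: t_def)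
  qed
  have cut: "(\<Sum>i<n. if i < k then f i else 0) = (\<Sum>i<k. f i)" for f :: "nat \<Rightarrow> real"
    using k by (subst sum.inter_filter [symmetric]) (auto intro!: sum.cong)
  have "(\<Sum>i<n. t i) = (\<Sum>i<n. d i * r i) - d (k - 1) * (\<Sum>i<n. r i)
      - (\<Sum>i<n. if i < k then b * d i else 0) + d (k - 1) * (\<Sum>i<n. if i < k then b else 0)"
    unfolding sum_distrib_left sum.distrib [symmetric] sum_subtractf [symmetric]
    by (intro sum.cong) (auto simp: t_def algebra_simps)
  then have sum_t: "(\<Sum>i<n. t i) = (\<Sum>i<n. d i * r i) - b * (\<Sum>i<k. d i)"
    unfolding cut by (simp add: total sum_distrib_left)
  have "0 \<le> (\<Sum>i<n. t i)" using t by (intro sum_nonneg) auto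
  then show "b * (\<Sum>i<k. d i) \<le> (\<Sum>i<n. d i * r i)" using sum_t by simp
  assume eq: "(\<Sum>i<n. d i * r i) = b * (\<Sum>i<k. d i)" and i: "i < n"
  have "(\<Sum>i<n. t i) = 0" using sum_t eq by simp
  then have ti: "t i = 0" using t i by (subst (asm) sum_nonneg_eq_0_iff) auto
  \<comment> \<open>Since \<open>t i\<close> vanishes while \<open>d i\<close> is off the threshold,
    \<open>r i\<close> agrees with the filling; monotonicity decides on which side of
    \<open>k\<close> the index lies.\<close>
  show "r i = b" if "d i < d (k - 1)"
  proof -
    have "i < k"
    proof (rule ccontr)
      assume "\<not> i < k"
      then have "d (k - 1) \<le> d i" using i by (intro mono_onD [OF mono]) auto
      then show False using that by simp
    qed
    then show ?thesis using ti that by (simp add: t_def)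
  qed
  show "r i = 0" if "d (k - 1) < d i"
  proof -
    have "\<not> i < k"
    proof
      assume "i < k"
      then have "d i \<le> d (k - 1)" using k by (intro mono_onD [OF mono]) auto
      then show False using that by simp
    qed
    then show ?thesis using ti that by (simp add: t_def)
  qed
qed

subsection \<open>The trace lower bound in Williamson coordinates\<close>

text \<open>The Williamson normal form as it stands in \<open>symplectic_eigenvalues\<close>. The
  size is a parameter because the same family \<open>d\<close>, cut off at \<open>k\<close>, also
  gives the diagonal matrix of the first \<open>k\<close> eigenvalues.\<close>

definition double_diag :: "nat \<Rightarrow> (nat \<Rightarrow> real) \<Rightarrow> real mat" where
  "double_diag n d = four_block_mat (mat_diag n d) (0\<^sub>m n n) (0\<^sub>m n n) (mat_diag n d)"

lemma double_diag_eq: "double_diag n d = mat_diag (2 * n) (\<lambda>i. d (if i < n then i else i - n))"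
  by (rule eq_matI) (auto simp: double_diag_def mat_diag_def)

lemma double_diag_dim [simp]:
  "dim_row (double_diag n d) = 2 * n" "dim_col (double_diag n d) = 2 * n"
  by (simp_all add: double_diag_eq mat_diag_def)

lemma double_diag_mult_index:
  assumes "i < 2 * n" "j < dim_col A" "dim_row A = 2 * n"
  shows "(double_diag n d * A) $$ (i, j) = d (if i < n then i else i - n) * A $$ (i, j)"
  unfolding double_diag_eq using assms by (subst mat_diag_mult_left) auto

lemma mult_double_diag_index:
  assumes "i < dim_row A" "j < 2 * n" "dim_col A = 2 * n"
  shows "(A * double_diag n d) $$ (i, j) = A $$ (i, j) * d (if j < n then j else j - n)"
  unfolding double_diag_eq using assms by (subst mat_diag_mult_right) auto

text \<open>Cyclicity of the trace brings in \<open>Y * Y\<^sup>T\<close>, whose diagonal holds the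
  squared row norms; the rows \<open>i\<close> and \<open>i + n\<close> share the weight
  \<open>d i\<close>.\<close>

lemma double_diag_trace:
  assumes Y: "Y \<in> carrier_mat (2 * n) m"
  shows "mat_trace (Y\<^sup>T * (double_diag n d * Y)) =
    (\<Sum>i<n. d i * (row Y i \<bullet> row Y i + row Y (i + n) \<bullet> row Y (i + n)))"
proof -
  have "mat_trace (Y\<^sup>T * (double_diag n d * Y)) = mat_trace ((double_diag n d * Y) * Y\<^sup>T)"
    using Y by (intro mat_trace_comm) auto
  also have "\<dots> = mat_trace (double_diag n d * (Y * Y\<^sup>T))"
    using Y by (simp add: mult_assoc_dim)
  also have "\<dots> = (\<Sum>i<2*n. d (if i < n then i else i - n) * (row Y i \<bullet> row Y i))"
    unfolding mat_trace_def using Y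
    by (intro sum.cong) (auto simp: double_diag_mult_index simp del: index_mult_mat(1),
        (simp add: index_mult_transpose)+)
  also have "\<dots> = (\<Sum>i<n. d i * (row Y i \<bullet> row Y i + row Y (i + n) \<bullet> row Y (i + n)))"
    unfolding sum_lessThan_double by (intro sum.cong) (auto simp: algebra_simps)
  finally show ?thesis .
qed

text \<open>J acts on a row through its transpose, whence the minus sign.\<close>

lemma row_mult_J:
  assumes "A \<in> carrier_mat m (2 * n)" "i < m"
  shows "row (A * J_mat n) i = - (J_mat n *\<^sub>v row A i)"
  using assms
  by (intro eq_vecI) (auto simp: mult_J_index J_mult_vec_index simp del: index_mult_mat(1) index_mult_mat_vec)

lemma row_J_mult:
  assumes "A \<in> carrier_mat (2 * n) m" "i < n"
  shows "row (J_mat n * A) i = row A (i + n)" "row (J_mat n * A) (i + n) = - row A i"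
  using assms by (auto intro!: eq_vecI simp: J_mult_index simp del: index_mult_mat(1))

lemma row_mult_J_norm:
  assumes "A \<in> carrier_mat m (2 * n)" "i < m"
  shows "row (A * J_mat n) i \<bullet> row (A * J_mat n) i = row A i \<bullet> row A i"
proof -
  have "row A i \<in> carrier_vec (2 * n)" using assms by auto
  then show ?thesis using row_mult_J [OF assms] J_vec_isometry by simp
qed

lemma Sp_carrier: "X \<in> Sp k n \<Longrightarrow> X \<in> carrier_mat (2 * n) (2 * k)"
  by (simp add: Sp_def)

lemma Sp_eq: "X \<in> Sp k n \<Longrightarrow> X\<^sup>T * (J_mat n * X) = J_mat k"
  by (auto simp: Sp_def mult_assoc_dim)

text \<open>\<open>P\<close> and \<open>Q\<close> are the complex linear and antilinear parts of \<open>Y\<close> with respect to the complex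
  structures given by the Poisson matrices.\<close>

lemma Sp_linear_antilinear:
  assumes "Y \<in> Sp k n"
  obtains P Q where "P \<in> carrier_mat (2 * n) (2 * k)" "Q \<in> carrier_mat (2 * n) (2 * k)"
    and "Y = P + Q" "J_mat n * P = P * J_mat k" "P\<^sup>T * P = 1\<^sub>m (2 * k) + Q\<^sup>T * Q"
    and "\<And>d. mat_trace (Y\<^sup>T * (double_diag n d * Y)) =
      mat_trace (P\<^sup>T * (double_diag n d * P)) + mat_trace (Q\<^sup>T * (double_diag n d * Q))"
proof -
  \<comment> \<open>Sending \<open>Y\<close> to \<open>- Z\<close> is an involution because both
    Poisson matrices square to minus the identity; \<open>P\<close> and \<open>Q\<close> are the
    parts of \<open>Y\<close> that it fixes and negates.\<close>
  define Z where "Z = J_mat n * (Y * J_mat k)"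
  define P where "P = mat (2 * n) (2 * k) (\<lambda>(i, j). (Y $$ (i, j) - Z $$ (i, j)) / 2)"
  define Q where "Q = mat (2 * n) (2 * k) (\<lambda>(i, j). (Y $$ (i, j) + Z $$ (i, j)) / 2)"
  have Y: "Y \<in> carrier_mat (2 * n) (2 * k)" using assms by (rule Sp_carrier)
  have Z: "Z \<in> carrier_mat (2 * n) (2 * k)" using Y by (auto simp: Z_def)
  have YJ: "Y * J_mat k \<in> carrier_mat (2 * n) (2 * k)" using Y by auto
  have dims [simp]: "dim_row Y = 2 * n" "dim_col Y = 2 * k" "dim_row Z = 2 * n" "dim_col Z = 2 * k"
      "dim_row P = 2 * n" "dim_col P = 2 * k" "dim_row Q = 2 * n" "dim_col Q = 2 * k"
    using Y Z by (auto simp: P_def Q_def)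
  have YJY: "Y\<^sup>T * (J_mat n * Y) = J_mat k" using assms by (rule Sp_eq)
  have "Y\<^sup>T * Z = Y\<^sup>T * (J_mat n * Y) * J_mat k"
    by (simp add: Z_def mult_assoc_dim)
  then have YZ: "Y\<^sup>T * Z = - 1\<^sub>m (2 * k)" by (simp add: YJY J_square)
  have "Z\<^sup>T * Y = (Y\<^sup>T * Z)\<^sup>T" by (simp add: transpose_mult_dim)
  then have ZY: "Z\<^sup>T * Y = - 1\<^sub>m (2 * k)" by (simp add: YZ transpose_minus)
  have JZ: "J_mat n * Z = - (Y * J_mat k)" by (simp add: Z_def J_J_mult)
  have ZJ: "Z * J_mat k = - (J_mat n * Y)"
    by (simp add: Z_def mult_assoc_dim J_square minus_mult_right_dim)
  have "Y = P + Q" by (rule eq_matI) (auto simp: P_def Q_def field_simps)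
  moreover have "J_mat n * P = P * J_mat k"
  proof (rule eq_matI)
    fix i j assume "i < dim_row (P * J_mat k)" "j < dim_col (P * J_mat k)"
    then have ij: "i < 2 * n" "j < 2 * k" by auto
    have "(J_mat n * P) $$ (i, j) = ((J_mat n * Y) $$ (i, j) - (J_mat n * Z) $$ (i, j)) / 2"
      using ij by (auto simp: J_mult_index P_def field_simps simp del: index_mult_mat(1))
    also have "\<dots> = ((Y * J_mat k) $$ (i, j) - (Z * J_mat k) $$ (i, j)) / 2"
      using ij by (simp add: JZ ZJ del: index_mult_mat(1))
    also have "\<dots> = (P * J_mat k) $$ (i, j)"
      using ij by (auto simp: mult_J_index P_def field_simps simp del: index_mult_mat(1))
    finally show "(J_mat n * P) $$ (i, j) = (P * J_mat k) $$ (i, j)" .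
  qed auto
  moreover have "P\<^sup>T * P = 1\<^sub>m (2 * k) + Q\<^sup>T * Q"
  proof (rule eq_matI)
    fix a b assume "a < dim_row (1\<^sub>m (2 * k) + Q\<^sup>T * Q)" "b < dim_col (1\<^sub>m (2 * k) + Q\<^sup>T * Q)"
    then have ab: "a < 2 * k" "b < 2 * k" by auto
    have gram: "(A\<^sup>T * B) $$ (a, b) = (\<Sum>l<2*n. A $$ (l, a) * B $$ (l, b))"
      if "A \<in> carrier_mat (2 * n) (2 * k)" "B \<in> carrier_mat (2 * n) (2 * k)" for A B :: "real mat"
      using that ab by (subst index_mult_mat_sum) auto
    \<comment> \<open>In the difference of the two Gram matrices the squares of \<open>Y\<close> and
      \<open>Z\<close> cancel. The cross terms remain, and the constraint makes each of them minus
      the identity.\<close>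
    have "(P\<^sup>T * P) $$ (a, b) = (Q\<^sup>T * Q) $$ (a, b) - ((Y\<^sup>T * Z) $$ (a, b) + (Z\<^sup>T * Y) $$ (a, b)) / 2"
    proof -
      have [simp]: "P \<in> carrier_mat (2 * n) (2 * k)" "Q \<in> carrier_mat (2 * n) (2 * k)" by auto
      show ?thesis
        using Y Z ab
        by (simp add: gram sum_divide_distrib flip: sum.distrib sum_subtractf del: index_mult_mat(1))
          (auto simp: P_def Q_def field_simps intro!: sum.cong)
    qed
    then show "(P\<^sup>T * P) $$ (a, b) = (1\<^sub>m (2 * k) + Q\<^sup>T * Q) $$ (a, b)"
      using ab by (simp add: YZ ZY del: index_mult_mat(1))
  qed auto
  moreover have "mat_trace (Y\<^sup>T * (double_diag n d * Y)) =
      mat_trace (P\<^sup>T * (double_diag n d * P)) + mat_trace (Q\<^sup>T * (double_diag n d * Q))" for d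
  proof -
    \<comment> \<open>The parallelogram law for half the difference and half the sum of
      \<open>Y\<close> and \<open>Z\<close>.\<close>
    have PQ: "row P i \<bullet> row P i + row Q i \<bullet> row Q i = (row Y i \<bullet> row Y i + row Z i \<bullet> row Z i) / 2"
      if "i < 2 * n" for i
      using that
      by (simp add: scalar_prod_def sum_divide_distrib flip: sum.distrib)
        (auto simp: P_def Q_def field_simps intro!: sum.cong)
    \<comment> \<open>Up to sign and an isometry, passing from \<open>Y\<close> to \<open>Z\<close>
      swaps the rows \<open>i\<close> and \<open>i + n\<close>. These share a weight, so both
      matrices have the same weighted norm.\<close>
    have Z_rows: "row Z i \<bullet> row Z i = row Y (i + n) \<bullet> row Y (i + n)"
      "row Z (i + n) \<bullet> row Z (i + n) = row Y i \<bullet> row Y i" if "i < n" for i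
      using that row_J_mult [OF YJ, of i] row_mult_J_norm [OF Y, of i]
        row_mult_J_norm [OF Y, of "i + n"]
      by (auto simp: Z_def)
    have [simp]: "P \<in> carrier_mat (2 * n) (2 * k)" "Q \<in> carrier_mat (2 * n) (2 * k)" by auto
    have "row Y i \<bullet> row Y i + row Y (i + n) \<bullet> row Y (i + n) =
        (row P i \<bullet> row P i + row P (i + n) \<bullet> row P (i + n))
      + (row Q i \<bullet> row Q i + row Q (i + n) \<bullet> row Q (i + n))" if "i < n" for i
      using PQ [of i] PQ [of "i + n"] Z_rows [OF that] that by simp
    then show ?thesis
      using Y by (simp add: double_diag_trace [where m = "2 * k"] flip: sum.distrib distrib_left)
  qed
  ultimately show thesis by (intro that [of P Q]) auto
qed

text \<open>\<open>bathtub\<close> applies to the pair sums of diagonal entries, which lie between 0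
  and 2 and total \<open>2 * k\<close>. A pair sum at either extreme fixes both of its
  entries.\<close>

lemma projection_weighted_trace:
  fixes d :: "nat \<Rightarrow> real" and G :: "real mat"
  assumes mono: "mono_on {..<n} d"
    and k: "1 \<le> k" "k \<le> n"
    and G: "G \<in> carrier_mat (2 * n) (2 * n)" "G\<^sup>T = G" "G * G = G" "mat_trace G = real (2 * k)"
  defines "T \<equiv> \<Sum>i<n. d i * (G $$ (i, i) + G $$ (i + n, i + n))"
  shows "2 * (\<Sum>i<k. d i) \<le> T"
    and "T = 2 * (\<Sum>i<k. d i) \<Longrightarrow> i < n \<Longrightarrow> d i < d (k - 1) \<Longrightarrow> G $$ (i, i) = 1"
    and "T = 2 * (\<Sum>i<k. d i) \<Longrightarrow> i < n \<Longrightarrow> d (k - 1) < d i \<Longrightarrow>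
      G $$ (i, i) = 0 \<and> G $$ (i + n, i + n) = 0"
proof -
  note bounds = projection_diag_bounds [OF G(1-3)]
  define r where "r i = G $$ (i, i) + G $$ (i + n, i + n)" for i
  have r: "0 \<le> r i" "r i \<le> 2" if "i < n" for i
    using bounds [of i] bounds [of "i + n"] that by (auto simp: r_def)
  have total: "(\<Sum>i<n. r i) = 2 * real k"
    using G(1,4) sum_lessThan_double [of "\<lambda>i. G $$ (i, i)" n]
    by (simp add: mat_trace_def r_def)
  note bt = bathtub [where d = d and r = r and n = n and k = k and b = 2, OF mono k r total]
  have T: "T = (\<Sum>i<n. d i * r i)" by (simp add: T_def r_def)
  show "2 * (\<Sum>i<k. d i) \<le> T" using bt(1) T by simp
  assume eq: "T = 2 * (\<Sum>i<k. d i)" and i: "i < n"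
  show "G $$ (i, i) = 1" if "d i < d (k - 1)"
    using bt(2) [of i] eq T i that bounds [of i] bounds [of "i + n"] by (simp add: r_def)
  show "G $$ (i, i) = 0 \<and> G $$ (i + n, i + n) = 0" if "d (k - 1) < d i"
    using bt(3) [of i] eq T i that bounds [of i] bounds [of "i + n"] by (simp add: r_def)
qed

text \<open>The bound comes from \<open>P\<close> alone, through a projection below
  \<open>P * P\<^sup>T\<close>. The part \<open>Q\<close> adds a nonnegative amount and, all weights
  being positive, can add 0 only by vanishing.\<close>

lemma Sp_trace_bound:
  fixes d :: "nat \<Rightarrow> real"
  assumes Y: "Y \<in> Sp k n" and k: "1 \<le> k" "k \<le> n"
    and pos: "\<forall>i<n. 0 < d i"
    and mono: "mono_on {..<n} d"
  shows "2 * (\<Sum>i<k. d i) \<le> mat_trace (Y\<^sup>T * (double_diag n d * Y))"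
    and "mat_trace (Y\<^sup>T * (double_diag n d * Y)) = 2 * (\<Sum>i<k. d i) \<Longrightarrow>
      J_mat n * Y = Y * J_mat k \<and> Y\<^sup>T * Y = 1\<^sub>m (2 * k)"
proof -
  obtain P Q where P: "P \<in> carrier_mat (2 * n) (2 * k)" and Q: "Q \<in> carrier_mat (2 * n) (2 * k)"
    and Y_eq: "Y = P + Q" and JP: "J_mat n * P = P * J_mat k"
    and PP: "P\<^sup>T * P = 1\<^sub>m (2 * k) + Q\<^sup>T * Q"
    and trace: "mat_trace (Y\<^sup>T * (double_diag n d * Y)) =
      mat_trace (P\<^sup>T * (double_diag n d * P)) + mat_trace (Q\<^sup>T * (double_diag n d * Q))"
    using Sp_linear_antilinear [OF Y] by metis
  \<comment> \<open>The Gram matrix of \<open>P\<close> is the identity plus that of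
    \<open>Q\<close>, so \<open>P\<close> shrinks no vector.\<close>
  have expand: "v \<bullet> v \<le> (P *\<^sub>v v) \<bullet> (P *\<^sub>v v)" if v: "v \<in> carrier_vec (2 * k)" for v
  proof -
    have gram: "(A *\<^sub>v v) \<bullet> (A *\<^sub>v v) = ((A\<^sup>T * A) *\<^sub>v v) \<bullet> v"
      if A: "A \<in> carrier_mat (2 * n) (2 * k)" for A :: "real mat"
      using transpose_vec_mult_scalar [of A "2 * n" "2 * k" v "A *\<^sub>v v"] A v
        assoc_mult_mat_vec [of "A\<^sup>T" "2 * k" "2 * n" A "2 * k" v]
      by simp
    have "(P *\<^sub>v v) \<bullet> (P *\<^sub>v v) = (1\<^sub>m (2 * k) *\<^sub>v v + (Q\<^sup>T * Q) *\<^sub>v v) \<bullet> v"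
      unfolding gram [OF P] PP using Q v by (subst add_mult_distrib_mat_vec) auto
    also have "\<dots> = v \<bullet> v + (Q *\<^sub>v v) \<bullet> (Q *\<^sub>v v)"
      unfolding gram [OF Q] using Q v by (subst add_scalar_prod_distrib [of _ "2 * k"]) auto
    finally show ?thesis using scalar_prod_self_nonneg [of "Q *\<^sub>v v"] by simp
  qed
  obtain G where G: "G \<in> carrier_mat (2 * n) (2 * n)" "G\<^sup>T = G" "G * G = G"
      "mat_trace G = real (2 * k)"
    and below: "\<And>i. i < 2 * n \<Longrightarrow> G $$ (i, i) \<le> row P i \<bullet> row P i"
    using projection_below_gram [OF P expand] by blast
  have "2 * (\<Sum>i<k. d i) \<le> (\<Sum>i<n. d i * (G $$ (i, i) + G $$ (i + n, i + n)))"
    by (rule projection_weighted_trace(1) [OF mono k G])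
  also have "\<dots> \<le> mat_trace (P\<^sup>T * (double_diag n d * P))"
    unfolding double_diag_trace [OF P]
  proof (rule sum_mono, rule mult_left_mono)
    fix i assume "i \<in> {..<n}"
    then show "G $$ (i, i) + G $$ (i + n, i + n)
        \<le> row P i \<bullet> row P i + row P (i + n) \<bullet> row P (i + n)" "0 \<le> d i"
      using below [of i] below [of "i + n"] pos by auto
  qed
  finally have P_bound: "2 * (\<Sum>i<k. d i) \<le> mat_trace (P\<^sup>T * (double_diag n d * P))" .
  have nonneg: "0 \<le> d i * (row Q i \<bullet> row Q i + row Q (i + n) \<bullet> row Q (i + n))" if "i < n" for i
    using pos that scalar_prod_self_nonneg by (simp add: less_imp_le)
  have "0 \<le> mat_trace (Q\<^sup>T * (double_diag n d * Q))"
    unfolding double_diag_trace [OF Q] using nonneg by (intro sum_nonneg) auto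
  then show "2 * (\<Sum>i<k. d i) \<le> mat_trace (Y\<^sup>T * (double_diag n d * Y))"
    using P_bound trace by simp
  assume "mat_trace (Y\<^sup>T * (double_diag n d * Y)) = 2 * (\<Sum>i<k. d i)"
  then have "mat_trace (Q\<^sup>T * (double_diag n d * Q)) = 0"
    using P_bound trace \<open>0 \<le> mat_trace (Q\<^sup>T * (double_diag n d * Q))\<close> by simp
  then have Q_sum: "\<forall>i<n. d i * (row Q i \<bullet> row Q i + row Q (i + n) \<bullet> row Q (i + n)) = 0"
    unfolding double_diag_trace [OF Q] using nonneg by (subst (asm) sum_nonneg_eq_0_iff) auto
  have Q_rows: "row Q i \<bullet> row Q i = 0" "row Q (i + n) \<bullet> row Q (i + n) = 0" if "i < n" for i
  proof -
    have "row Q i \<bullet> row Q i + row Q (i + n) \<bullet> row Q (i + n) = 0"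
      using Q_sum pos that by (metis less_irrefl mult_eq_0_iff)
    then show "row Q i \<bullet> row Q i = 0" "row Q (i + n) \<bullet> row Q (i + n) = 0"
      using scalar_prod_self_nonneg [of "row Q i"] scalar_prod_self_nonneg [of "row Q (i + n)"]
      by linarith+
  qed
  have Q0: "Q = 0\<^sub>m (2 * n) (2 * k)"
  proof (rule eq_matI)
    fix i j assume "i < dim_row (0\<^sub>m (2 * n) (2 * k) :: real mat)" "j < dim_col (0\<^sub>m (2 * n) (2 * k) :: real mat)"
    then have ij: "i < 2 * n" "j < 2 * k" by auto
    have "row Q i \<bullet> row Q i = 0"
      using Q_rows(1) [of i] Q_rows(2) [of "i - n"] ij by (cases "i < n") auto
    then have "row Q i $ j = 0"
      using scalar_prod_self_eq_0 [of "row Q i"] ij Q by (metis carrier_matD(2) index_row(2) index_zero_vec(1))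
    then show "Q $$ (i, j) = 0\<^sub>m (2 * n) (2 * k) $$ (i, j)" using ij Q by simp
  qed (use Q in auto)
  have "Y = P" using Y_eq Q0 P by simp
  moreover have "P\<^sup>T * P = 1\<^sub>m (2 * k)" using PP Q0 by simp
  ultimately show "J_mat n * Y = Y * J_mat k \<and> Y\<^sup>T * Y = 1\<^sub>m (2 * k)" using JP by simp
qed

subsection \<open>Extending to an orthosymplectic matrix\<close>

text \<open>The vectors \<open>v i\<close> and \<open>J (v i)\<close> with \<open>i < l\<close> together form an orthonormal system; the
  orthogonality of the \<open>J (v i)\<close> among themselves is implied.\<close>

definition J_orthonormal :: "nat \<Rightarrow> nat \<Rightarrow> (nat \<Rightarrow> real vec) \<Rightarrow> bool" where
  "J_orthonormal k l v \<longleftrightarrow> (\<forall>i<l. v i \<in> carrier_vec (2 * k)) \<and>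
     (\<forall>i<l. \<forall>j<l. v i \<bullet> v j = (if i = j then 1 else 0) \<and> v i \<bullet> (J_mat k *\<^sub>v v j) = 0)"

text \<open>The vectors \<open>v i\<close> and their images under J are too few to span the space
  when \<open>l < k\<close>, so some unit vector \<open>u\<close> is orthogonal to all of them.
  Skewness of J supplies the conditions on the image of \<open>u\<close>.\<close>

lemma J_orthonormal_step:
  assumes v: "J_orthonormal k l v" and l: "l < k"
  obtains u where "J_orthonormal k (Suc l) (v(l := u))"
proof -
  have vc: "v i \<in> carrier_vec (2 * k)" if "i < l" for i
    using v that by (simp add: J_orthonormal_def)
  define c where "c r = (if r < l then v r else J_mat k *\<^sub>v v (r - l))" for r
  define A where "A = mat\<^sub>r (2 * k) (2 * k) (\<lambda>r. if r < 2 * l then c r else 0\<^sub>v (2 * k))"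
  have A: "A \<in> carrier_mat (2 * k) (2 * k)" by (simp add: A_def)
  have c: "c r \<in> carrier_vec (2 * k)" if "r < 2 * l" for r
    using that vc by (auto simp: c_def)
  \<comment> \<open>The system was padded with zero rows to a square matrix. Its last row is padding
    because \<open>l < k\<close>, and displaying it as zero gives the form that
    \<open>det_row_0\<close> matches.\<close>
  have "A = mat\<^sub>r (2 * k) (2 * k) (\<lambda>r. if r = 2 * k - 1 then 0\<^sub>v (2 * k)
      else if r < 2 * l then c r else 0\<^sub>v (2 * k))"
    unfolding A_def using l by (intro arg_cong [where f = "mat\<^sub>r (2 * k) (2 * k)"]) auto
  also have "det \<dots> = 0"
    using l c by (intro det_row_0) auto
  finally obtain z where z: "z \<in> carrier_vec (2 * k)" "z \<noteq> 0\<^sub>v (2 * k)" "A *\<^sub>v z = 0\<^sub>v (2 * k)"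
    using det_0_iff_vec_prod_zero [OF A] by auto
  have orth: "c r \<bullet> z = 0" if "r < 2 * l" for r
  proof -
    have "(A *\<^sub>v z) $ r = row A r \<bullet> z" using that l A by simp
    also have "row A r = c r" using that l c by (simp add: A_def)
    finally show ?thesis using z that l by simp
  qed
  define u where "u = (1 / sqrt (z \<bullet> z)) \<cdot>\<^sub>v z"
  have zz: "z \<bullet> z > 0"
    using scalar_prod_self_nonneg [of z] scalar_prod_self_eq_0 [of z] z
    by (metis carrier_vecD less_eq_real_def)
  have u: "u \<in> carrier_vec (2 * k)" using z by (simp add: u_def)
  have uu: "u \<bullet> u = 1" using zz z by (simp add: u_def field_simps)
  have vu: "v i \<bullet> u = 0" if "i < l" for i
    using orth [of i] that z vc [of i] by (simp add: c_def u_def)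
  have Jvu: "(J_mat k *\<^sub>v v i) \<bullet> u = 0" if "i < l" for i
    using orth [of "i + l"] that z vc [of i] by (simp add: c_def u_def)
  have uv: "u \<bullet> v i = 0" "u \<bullet> (J_mat k *\<^sub>v v i) = 0" "v i \<bullet> (J_mat k *\<^sub>v u) = 0" if "i < l" for i
    using vu [OF that] Jvu [OF that] J_vec_scalar [OF vc [OF that] u]
      comm_scalar_prod [OF u vc [OF that]] comm_scalar_prod [OF u J_vec_carrier, of "v i"]
    by auto
  have "J_orthonormal k (Suc l) (v(l := u))"
    using v u uu vu uv J_vec_orthogonal [OF u]
    by (auto simp: J_orthonormal_def less_Suc_eq)
  then show thesis by (rule that)
qed

lemma J_orthonormal_extend:
  assumes "J_orthonormal k l v" "l \<le> k"
  obtains u where "J_orthonormal k k u" "\<And>i. i < l \<Longrightarrow> u i = v i"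
proof -
  have "\<exists>u. J_orthonormal k k u \<and> (\<forall>i<l. u i = v i)"
    using assms(2,1)
  \<comment> \<open>The induction runs downwards from \<open>k\<close>: the case \<open>l\<close>
    follows from \<open>Suc l\<close>.\<close>
  proof (induction l arbitrary: v rule: inc_induct)
    case base
    then show ?case by blast
  next
    case (step l)
    obtain u where "J_orthonormal k (Suc l) (v(l := u))"
      using J_orthonormal_step [OF step.prems] step.hyps by blast
    from step.IH [OF this] obtain u' where
      "J_orthonormal k k u'" "\<forall>i<Suc l. u' i = (v(l := u)) i" by blast
    then show ?case by (intro exI [of _ u']) auto
  qed
  then show thesis using that by blast
qed

text \<open>The second half of the columns is chosen so that \<open>K\<close> commutes with J.
  Orthogonality then yields the symplectic condition, since J can be moved past
  \<open>K\<close>.\<close>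

lemma J_orthonormal_OrSp:
  assumes u: "J_orthonormal k k u"
  obtains K where "K \<in> OrSp k" "J_mat k * K = K * J_mat k" "\<And>j. j < k \<Longrightarrow> col K j = u j"
proof -
  have uc: "u i \<in> carrier_vec (2 * k)" if "i < k" for i
    using u that by (simp add: J_orthonormal_def)
  have uu: "u i \<bullet> u j = (if i = j then 1 else 0)" "u i \<bullet> (J_mat k *\<^sub>v u j) = 0"
    if "i < k" "j < k" for i j
    using u that by (auto simp: J_orthonormal_def)
  \<comment> \<open>The sign is dictated by commutation: for \<open>j < k\<close>, column
    \<open>j\<close> of \<open>K * J_mat k\<close> is minus column \<open>j + k\<close> of
    \<open>K\<close>.\<close>
  define c where "c j = (if j < k then u j else - (J_mat k *\<^sub>v u (j - k)))" for j
  define K where "K = mat (2 * k) (2 * k) (\<lambda>(i, j). c j $ i)"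
  have cc: "c j \<in> carrier_vec (2 * k)" if "j < 2 * k" for j
    using uc [of j] that by (auto simp: c_def)
  have K: "K \<in> carrier_mat (2 * k) (2 * k)" by (simp add: K_def)
  have dims [simp]: "dim_row K = 2 * k" "dim_col K = 2 * k" using K by auto
  have col: "col K j = c j" if "j < 2 * k" for j
    using that cc [OF that] by (intro eq_vecI) (auto simp: K_def)
  have "K\<^sup>T * K = 1\<^sub>m (2 * k)"
  proof (rule eq_matI)
    fix i j assume "i < dim_row (1\<^sub>m (2 * k) :: real mat)" "j < dim_col (1\<^sub>m (2 * k) :: real mat)"
    then have ij: "i < 2 * k" "j < 2 * k" by auto
    have "(K\<^sup>T * K) $$ (i, j) = c i \<bullet> c j" using ij by (simp add: col)
    also have "\<dots> = 1\<^sub>m (2 * k) $$ (i, j)"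
    proof (cases "i < k"; cases "j < k")
      assume "i < k" "j < k"
      then show ?thesis by (simp add: c_def uu)
    next
      assume "i < k" "\<not> j < k"
      then show ?thesis using ij uc by (simp add: c_def uu)
    next
      assume "\<not> i < k" "j < k"
      then show ?thesis using ij uc
        by (simp add: c_def uu J_vec_scalar uminus_scalar_prod [of _ "2 * k", symmetric])
    next
      assume "\<not> i < k" "\<not> j < k"
      then show ?thesis using ij uc by (auto simp: c_def uu J_vec_isometry)
    qed
    finally show "(K\<^sup>T * K) $$ (i, j) = 1\<^sub>m (2 * k) $$ (i, j)" .
  qed auto
  moreover have JK: "J_mat k * K = K * J_mat k"
  proof (rule eq_matI)
    fix i j assume "i < dim_row (K * J_mat k)" "j < dim_col (K * J_mat k)"
    then have ij: "i < 2 * k" "j < 2 * k" by auto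
    have "(J_mat k * K) $$ (i, j) = (J_mat k *\<^sub>v c j) $ i" using ij by (simp add: col)
    also have "\<dots> = (K * J_mat k) $$ (i, j)"
    proof (cases "j < k")
      case True
      then have "(K * J_mat k) $$ (i, j) = - (c (j + k) $ i)"
        using ij by (simp add: mult_J_index K_def del: index_mult_mat(1))
      then show ?thesis using True ij uc by (simp add: c_def)
    next
      case False
      then have "(K * J_mat k) $$ (i, j) = c (j - k) $ i"
        using ij by (simp add: mult_J_index K_def del: index_mult_mat(1))
      moreover have "u (j - k) \<in> carrier_vec (2 * k)" using False ij by (intro uc) auto
      moreover from this have "J_mat k *\<^sub>v - (J_mat k *\<^sub>v u (j - k)) = u (j - k)"
        by (intro eq_vecI) (auto simp: J_mult_vec_index simp del: index_mult_mat_vec)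
      moreover have "j - k < k" using False ij by simp
      ultimately show ?thesis using False by (simp add: c_def del: index_mult_mat_vec index_mult_mat(1))
    qed
    finally show "(J_mat k * K) $$ (i, j) = (K * J_mat k) $$ (i, j)" .
  qed auto
  ultimately have "K\<^sup>T * (J_mat k * K) = J_mat k"
    by (simp add: mult_assoc_dim [symmetric])
  then have "K \<in> Sp k k" using K by (simp add: Sp_def mult_assoc_dim)
  then have "K \<in> OrSp k" using \<open>K\<^sup>T * K = 1\<^sub>m (2 * k)\<close> by (simp add: OrSp_def)
  then show thesis using JK col by (intro that [of K]) (auto simp: c_def)
qed

text \<open>The two commutation relations together form the eigenvector equation in Williamson
  coordinates. The second one means that nonzero entries of \<open>Y * K\<close> occur only where
  row and column carry the same weight.\<close>

lemma Sp_trace_minimal_diagonalize: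
  fixes d :: "nat \<Rightarrow> real"
  assumes Y: "Y \<in> Sp k n" and k: "1 \<le> k" "k \<le> n"
    and pos: "\<forall>i<n. 0 < d i"
    and mono: "mono_on {..<n} d"
    and min: "mat_trace (Y\<^sup>T * (double_diag n d * Y)) = 2 * (\<Sum>i<k. d i)"
  obtains K where "K \<in> OrSp k" "J_mat n * (Y * K) = (Y * K) * J_mat k"
    "double_diag n d * (Y * K) = (Y * K) * double_diag k d"
proof -
  have JY: "J_mat n * Y = Y * J_mat k" and YY: "Y\<^sup>T * Y = 1\<^sub>m (2 * k)"
    using Sp_trace_bound(2) [where d = d, OF Y k pos mono min] by auto
  have Yc: "Y \<in> carrier_mat (2 * n) (2 * k)" using Y by (rule Sp_carrier)
  then have dims [simp]: "dim_row Y = 2 * n" "dim_col Y = 2 * k" by auto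
  \<comment> \<open>As \<open>Y\<close> has orthonormal columns, \<open>G\<close> is itself an
    orthogonal projection, and \<open>min\<close> says that its weighted trace is extremal.\<close>
  define G where "G = Y * Y\<^sup>T"
  have Gc: "G \<in> carrier_mat (2 * n) (2 * n)" by (auto simp: G_def)
  have GT: "G\<^sup>T = G" by (simp add: G_def transpose_mult_dim)
  have "G * G = Y * ((Y\<^sup>T * Y) * Y\<^sup>T)" by (simp add: G_def mult_assoc_dim)
  then have GG: "G * G = G" by (simp add: YY G_def)
  have "mat_trace G = mat_trace (Y\<^sup>T * Y)" unfolding G_def by (rule mat_trace_comm) auto
  then have G_trace: "mat_trace G = real (2 * k)" by (simp add: YY mat_trace_one)
  have G_index: "G $$ (i, j) = row Y i \<bullet> row Y j" if "i < 2 * n" "j < 2 * n" for i j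
    using that by (simp add: G_def)
  have min': "(\<Sum>i<n. d i * (G $$ (i, i) + G $$ (i + n, i + n))) = 2 * (\<Sum>i<k. d i)"
    using min by (simp add: double_diag_trace [OF Yc] G_index)
  note weights = projection_weighted_trace [where n = n and k = k and d = d and G = G, OF mono k Gc GT GG G_trace]
  define c where "c = d (k - 1)"
  \<comment> \<open>\<open>l\<close> counts the eigenvalues strictly below \<open>c\<close>; the
    indices from \<open>l\<close> to \<open>k - 1\<close> all carry the weight
    \<open>c\<close>.\<close>
  define l where "l = (LEAST i. c \<le> d i)"
  have l: "l \<le> k - 1" unfolding l_def by (rule Least_le) (simp add: c_def)
  have below: "d i < c" if "i < l" for i
    using not_less_Least [of i "\<lambda>i. c \<le> d i"] that by (simp add: l_def)
  have above: "c \<le> d i" if "l \<le> i" "i < n" for i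
  proof -
    have "c \<le> d l" unfolding l_def by (rule LeastI [of _ "k - 1"]) (simp add: c_def)
    also have "\<dots> \<le> d i" using that by (intro mono_onD [OF mono]) auto
    finally show ?thesis .
  qed
  have mid: "d i = c" if "l \<le> i" "i < k" for i
    using above [of i] mono_onD [OF mono, of i "k - 1"] that k by (simp add: c_def)
  have G_unit: "G $$ (i, i) = 1" if "i < l" for i
    using weights(2) [OF min', of i] below [OF that] that l k by (simp add: c_def)
  have G_zero: "row Y i = 0\<^sub>v (2 * k)" "row Y (i + n) = 0\<^sub>v (2 * k)" if "i < n" "c < d i" for i
    using weights(3) [OF min', of i] that scalar_prod_self_eq_0 [of "row Y i"]
      scalar_prod_self_eq_0 [of "row Y (i + n)"] G_index [of i i] G_index [of "i + n" "i + n"]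
    by (auto simp: c_def)
  \<comment> \<open>A diagonal entry 1 clears the rest of its row in \<open>G\<close>, so row
    \<open>i\<close> of \<open>Y\<close> is a unit vector orthogonal to every other row.\<close>
  have row_G: "row Y i \<bullet> row Y j = (if i = j then 1 else 0)" if "i < l" "j < 2 * n" for i j
  proof -
    have "i < 2 * n" using that l k by simp
    then show ?thesis
      using G_unit [OF that(1)] projection_diag_one [OF Gc GT GG, of i j] that
        G_index [of i j] by auto
  qed
  have rowc: "row Y i \<in> carrier_vec (2 * k)" for i by (rule carrier_vecI) simp
  have J_row: "J_mat k *\<^sub>v row Y i = - row Y (i + n)" if "i < n" for i
  proof -
    have "row Y (i + n) = row (Y * J_mat k) i"
      using row_J_mult(1) [OF Yc that] by (simp add: JY)
    also have "\<dots> = - (J_mat k *\<^sub>v row Y i)"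
      using row_mult_J [OF Yc, of i] that by simp
    finally show ?thesis by simp
  qed
  \<comment> \<open>By \<open>J_row\<close>, orthogonality to the image of row \<open>j\<close>
    under J is orthogonality to the partner row \<open>j + n\<close>, which \<open>row_G\<close>
    covers.\<close>
  have "J_orthonormal k l (row Y)"
    unfolding J_orthonormal_def
  proof (intro conjI allI impI)
    fix i j assume "i < l" "j < l"
    moreover from this have "i < n" "j < n" using l k by auto
    ultimately show "row Y i \<bullet> row Y j = (if i = j then 1 else 0)"
        "row Y i \<bullet> (J_mat k *\<^sub>v row Y j) = 0"
      using row_G [of i j] row_G [of i "j + n"] by (auto simp: J_row)
  qed (rule rowc)
  then obtain u where u: "J_orthonormal k k u" and u_row: "\<And>i. i < l \<Longrightarrow> u i = row Y i"
    using J_orthonormal_extend [of k l "row Y"] l by (metis diff_le_self le_trans)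
  have uc: "u i \<in> carrier_vec (2 * k)" if "i < k" for i
    using u that by (simp add: J_orthonormal_def)
  have uu: "u i \<bullet> u j = (if i = j then 1 else 0)" "u i \<bullet> (J_mat k *\<^sub>v u j) = 0"
    if "i < k" "j < k" for i j
    using u that by (auto simp: J_orthonormal_def)
  obtain K where K: "K \<in> OrSp k" and JK: "J_mat k * K = K * J_mat k"
    and col: "\<And>j. j < k \<Longrightarrow> col K j = u j"
    using J_orthonormal_OrSp [OF u] by blast
  have Kc: "K \<in> carrier_mat (2 * k) (2 * k)" using K by (simp add: OrSp_def Sp_def)
  then have [simp]: "dim_row K = 2 * k" "dim_col K = 2 * k" by auto
  define Z where "Z = Y * K"
  have [simp]: "dim_row Z = 2 * n" "dim_col Z = 2 * k" by (simp_all add: Z_def)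
  have JZ: "J_mat n * Z = Z * J_mat k"
  proof -
    have "J_mat n * Z = (J_mat n * Y) * K" by (simp add: Z_def mult_assoc_dim)
    also have "\<dots> = Z * J_mat k" unfolding JY by (simp add: Z_def mult_assoc_dim JK)
    finally show ?thesis .
  qed
  define w where "w m i = d (if i < m then i else i - m)" for m i
  \<comment> \<open>Only the first \<open>k\<close> columns are treated here; the others follow
    below from \<open>JZ\<close>.\<close>
  have support: "w n i = d j" if "i < 2 * n" "j < k" "Z $$ (i, j) \<noteq> 0" for i j
  proof (rule ccontr)
    assume neq: "w n i \<noteq> d j"
    have Zij: "Z $$ (i, j) = row Y i \<bullet> u j" using that by (simp add: Z_def col)
    define i' where "i' = (if i < n then i else i - n)"
    have i': "i' < n" "i = i' \<or> i = i' + n" "w n i = d i'"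
      using that by (auto simp: i'_def w_def)
    show False
    proof (cases "j < l")
      case True
      \<comment> \<open>Column \<open>j\<close> of \<open>Z\<close> is \<open>Y\<close> applied to
        its own row \<open>j\<close>, hence column \<open>j\<close> of \<open>G\<close>, a standard
        basis vector.\<close>
      have "row Y i \<bullet> u j = row Y j \<bullet> row Y i"
        using True comm_scalar_prod [OF rowc rowc] by (simp add: u_row)
      then have "i = j" using row_G [OF True that(1)] Zij that(3) by (auto split: if_splits)
      then show False using neq that(2) k by (simp add: w_def)
    next
      case False
      then have dj: "d j = c" using mid that(2) by simp
      have "\<not> c < d i'" 
      proof
        assume "c < d i'"
        then have "row Y i = 0\<^sub>v (2 * k)" using G_zero [OF i'(1)] i'(2) by auto
        then show False using Zij that(3) uc [OF that(2)] by simp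
      qed
      then have "d i' < c" using neq dj i'(3) by simp
      then have i'l: "i' < l" using above [of i'] i'(1) by (meson not_less)
      then have i'k: "i' < k" and ne: "i' \<noteq> j" using l k False by auto
      \<comment> \<open>Row \<open>i'\<close> of \<open>Y\<close> is the column \<open>u i'\<close>
        of \<open>K\<close>, and its partner row is minus the image of \<open>u i'\<close> under J.
        Both are orthogonal to \<open>u j\<close>.\<close>
      have "row Y i' \<bullet> u j = 0" using uu(1) [OF i'k that(2)] ne u_row [OF i'l] by simp
      moreover have "row Y (i' + n) \<bullet> u j = 0"
      proof -
        have "row Y (i' + n) = - (J_mat k *\<^sub>v u i')" using J_row [OF i'(1)] u_row [OF i'l] by simp
        then show ?thesis
          using uc [OF i'k] uc [OF that(2)] uu(2) [OF i'k that(2)]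
          by (simp add: J_vec_scalar uminus_scalar_prod [of _ "2 * k", symmetric])
      qed
      ultimately show False using i'(2) Zij that(3) by auto
    qed
  qed
  have "double_diag n d * Z = Z * double_diag k d"
  proof (rule eq_matI)
    fix i j assume "i < dim_row (Z * double_diag k d)" "j < dim_col (Z * double_diag k d)"
    then have ij: "i < 2 * n" "j < 2 * k" by auto
    have "w n i = w k j" if nz: "Z $$ (i, j) \<noteq> 0"
    proof (cases "j < k")
      case True
      then show ?thesis using support [OF ij(1) True nz] by (simp add: w_def)
    next
      case False
      \<comment> \<open>Commutation with J moves the entry to column \<open>j - k\<close> and to the
        partner row, which carries the same weight.\<close>
      have "(J_mat n * Z) $$ (i, j - k) = - Z $$ (i, j)"
        unfolding JZ using ij False by (subst mult_J_index) auto
      then have "Z $$ (if i < n then i + n else i - n, j - k) \<noteq> 0"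
        using nz ij False by (auto simp: J_mult_index simp del: index_mult_mat(1) split: if_splits)
      then have "w n (if i < n then i + n else i - n) = d (j - k)"
        using ij False by (intro support) auto
      then show ?thesis using False ij by (auto simp: w_def split: if_splits)
    qed
    then show "(double_diag n d * Z) $$ (i, j) = (Z * double_diag k d) $$ (i, j)"
      using ij by (cases "Z $$ (i, j) = 0")
        (auto simp: double_diag_mult_index mult_double_diag_index w_def simp del: index_mult_mat(1))
  qed auto
  then show thesis using K JZ by (intro that [of K]) (auto simp: Z_def)
qed

subsection \<open>Reduction to Williamson coordinates\<close>

lemma Sp_mult:
  assumes A: "A \<in> Sp m n" and B: "B \<in> Sp k m"
  shows "A * B \<in> Sp k n"
proof -
  have [simp]: "dim_row A = 2 * n" "dim_col A = 2 * m" "dim_row B = 2 * m" "dim_col B = 2 * k"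
    using Sp_carrier [OF A] Sp_carrier [OF B] by auto
  have "(A * B)\<^sup>T * (J_mat n * (A * B)) = B\<^sup>T * ((A\<^sup>T * (J_mat n * A)) * B)"
    by (simp add: transpose_mult_dim mult_assoc_dim)
  also have "\<dots> = J_mat k" by (simp add: Sp_eq [OF A] Sp_eq [OF B])
  finally show ?thesis by (auto simp: Sp_def mult_assoc_dim)
qed

text \<open>The symplectic condition exhibits \<open>- (J_mat n * (S\<^sup>T * J_mat n))\<close> as
  a left inverse, which is two-sided because \<open>S\<close> is square.\<close>

lemma Sp_inverse:
  assumes S: "S \<in> Sp n n"
  obtains R where "R \<in> Sp n n" "S * R = 1\<^sub>m (2 * n)" "R * S = 1\<^sub>m (2 * n)"
proof -
  have Sc: "S \<in> carrier_mat (2 * n) (2 * n)" using S by (rule Sp_carrier)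
  then have [simp]: "dim_row S = 2 * n" "dim_col S = 2 * n" by auto
  define R where "R = - (J_mat n * (S\<^sup>T * J_mat n))"
  have Rc: "R \<in> carrier_mat (2 * n) (2 * n)" by (auto simp: R_def)
  then have [simp]: "dim_row R = 2 * n" "dim_col R = 2 * n" by auto
  have "R * S = - (J_mat n * (S\<^sup>T * (J_mat n * S)))"
    by (simp add: R_def minus_mult_left_dim mult_assoc_dim)
  then have RS: "R * S = 1\<^sub>m (2 * n)" by (simp add: Sp_eq [OF S] J_square)
  then have SR: "S * R = 1\<^sub>m (2 * n)" using mat_mult_left_right_inverse [OF Rc Sc] by simp
  have "R\<^sup>T * (J_mat n * R) = R\<^sup>T * ((S\<^sup>T * (J_mat n * S)) * R)"
    by (simp add: Sp_eq [OF S])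
  also have "\<dots> = (S * R)\<^sup>T * (J_mat n * (S * R))"
    by (simp add: transpose_mult_dim mult_assoc_dim)
  also have "\<dots> = J_mat n" by (simp add: SR)
  finally have "R \<in> Sp n n" using Rc by (simp add: Sp_def mult_assoc_dim)
  then show thesis using SR RS by (rule that)
qed

lemma trace_double_diag: "mat_trace (double_diag k d) = 2 * (\<Sum>i<k. d i)"
  unfolding mat_trace_def
  by (simp add: sum_lessThan_double double_diag_eq mat_diag_def sum_distrib_left)

text \<open>The columns of the witness are the standard basis vectors at the first \<open>k\<close>
  indices and at their partners shifted by \<open>n\<close>. This matrix intertwines both the
  Poisson matrices and the diagonal ones.\<close>

lemma Sp_trace_attained:
  assumes k: "k \<le> n"
  obtains E where "E \<in> Sp k n" "mat_trace (E\<^sup>T * (double_diag n d * E)) = 2 * (\<Sum>i<k. d i)"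
proof -
  define e where "e j = (if j < k then j else j - k + n)" for j
  define E :: "real mat" where "E = mat (2 * n) (2 * k) (\<lambda>(i, j). if i = e j then 1 else 0)"
  have [simp]: "dim_row E = 2 * n" "dim_col E = 2 * k" by (simp_all add: E_def)
  have e: "e j < 2 * n" if "j < 2 * k" for j using that k by (auto simp: e_def)
  have e_inj: "e i = e j \<longleftrightarrow> i = j" if "i < 2 * k" "j < 2 * k" for i j
    using that k by (auto simp: e_def)
  have EE: "E\<^sup>T * E = 1\<^sub>m (2 * k)"
  proof (rule eq_matI)
    fix i j assume "i < dim_row (1\<^sub>m (2 * k) :: real mat)" "j < dim_col (1\<^sub>m (2 * k) :: real mat)"
    then have ij: "i < 2 * k" "j < 2 * k" by auto
    have "(E\<^sup>T * E) $$ (i, j) = (\<Sum>l<2*n. E $$ (l, i) * E $$ (l, j))"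
      using ij by (subst index_mult_mat_sum) auto
    also have "\<dots> = (\<Sum>l<2*n. if l = e i then (if e i = e j then 1 else 0) else 0)"
      using ij by (intro sum.cong) (auto simp: E_def)
    also have "\<dots> = 1\<^sub>m (2 * k) $$ (i, j)" using ij e by (simp add: e_inj)
    finally show "(E\<^sup>T * E) $$ (i, j) = 1\<^sub>m (2 * k) $$ (i, j)" .
  qed auto
  have "J_mat n * E = E * J_mat k"
    using k by (intro eq_matI)
      (auto simp: J_mult_index mult_J_index E_def e_def simp del: index_mult_mat(1))
  then have "E\<^sup>T * (J_mat n * E) = (E\<^sup>T * E) * J_mat k" by (simp add: mult_assoc_dim)
  then have "E \<in> Sp k n" by (auto simp: Sp_def mult_assoc_dim EE)
  moreover have "double_diag n d * E = E * double_diag k d"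
    using k by (intro eq_matI)
      (auto simp: double_diag_mult_index mult_double_diag_index E_def e_def simp del: index_mult_mat(1))
  then have "E\<^sup>T * (double_diag n d * E) = (E\<^sup>T * E) * double_diag k d" by (simp add: mult_assoc_dim)
  then have "mat_trace (E\<^sup>T * (double_diag n d * E)) = 2 * (\<Sum>i<k. d i)"
    by (simp add: EE trace_double_diag)
  ultimately show thesis by (rule that)
qed

text \<open>With J factored out, the block in the eigenvector equation can be cancelled through
  \<open>J_J_mult\<close>.\<close>

lemma eigenvector_block_eq:
  "four_block_mat (0\<^sub>m k k) (- mat_diag k l) (mat_diag k l) (0\<^sub>m k k) = - (J_mat k * double_diag k l)"
  by (rule eq_matI) (auto simp: J_mult_index double_diag_def mat_diag_def simp del: index_mult_mat(1))

theorem theorem4p6: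
  fixes n k :: nat and M :: "real mat" and d :: "nat \<Rightarrow> real"
  assumes "M \<in> carrier_mat (2 * n) (2 * n)"
    and "M\<^sup>T = M"
    and "positive_definite_mat (2 * n) M"
    and "symplectic_eigenvalues n M d"
    and "1 \<le> k" and "k \<le> n"
  shows "(\<forall>X \<in> Sp k n. global_minimizer k n M X \<longrightarrow>
            (\<forall>K \<in> OrSp k. global_minimizer k n M (X * K))) \<and>
         (\<forall>X \<in> Sp k n. global_minimizer k n M X \<longleftrightarrow>
            (\<exists>K \<in> OrSp k. normalized_symplectic_eigenvector_set k n M d (X * K)))"
proof -
  have pos: "\<forall>i<n. 0 < d i" and mono: "mono_on {..<n} d"
    using assms(4) by (auto simp: symplectic_eigenvalues_def intro: mono_onI)
  obtain S where S: "S \<in> Sp n n" and SMS': "S\<^sup>T * M * S = double_diag n d"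
    using assms(4) by (auto simp: symplectic_eigenvalues_def double_diag_def)
  have [simp]: "dim_row M = 2 * n" "dim_col M = 2 * n" using assms(1) by auto
  have [simp]: "dim_row S = 2 * n" "dim_col S = 2 * n" using Sp_carrier [OF S] by auto
  have SMS: "S\<^sup>T * (M * S) = double_diag n d" using SMS' by (simp add: mult_assoc_dim)
  obtain R where R: "R \<in> Sp n n" and SR: "S * R = 1\<^sub>m (2 * n)" and RS: "R * S = 1\<^sub>m (2 * n)"
    using Sp_inverse [OF S] .
  have [simp]: "dim_row R = 2 * n" "dim_col R = 2 * n" using Sp_carrier [OF R] by auto
  have RTST: "R\<^sup>T * S\<^sup>T = 1\<^sub>m (2 * n)"
    using SR transpose_mult_dim [of S R] by simp
  define f where "f X = mat_trace (X\<^sup>T * M * X)" for X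
  \<comment> \<open>Substituting \<open>S * Y\<close> turns \<open>M\<close> into its normal form;
    by \<open>coords\<close> every feasible \<open>X\<close> arises in this way.\<close>
  have f_S: "f (S * Y) = mat_trace (Y\<^sup>T * (double_diag n d * Y))" if "Y \<in> Sp k n" for Y
  proof -
    have [simp]: "dim_row Y = 2 * n" "dim_col Y = 2 * k" using Sp_carrier [OF that] by auto
    have "(S * Y)\<^sup>T * M * (S * Y) = Y\<^sup>T * ((S\<^sup>T * (M * S)) * Y)"
      by (simp add: transpose_mult_dim mult_assoc_dim)
    then show ?thesis by (simp add: f_def SMS)
  qed
  have coords: "\<exists>Y \<in> Sp k n. X = S * Y" if "X \<in> Sp k n" for X
  proof
    have [simp]: "dim_row X = 2 * n" using Sp_carrier [OF that] by auto
    show "R * X \<in> Sp k n" by (rule Sp_mult [OF R that])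
    show "X = S * (R * X)" by (simp add: mult_assoc_dim [symmetric] SR)
  qed
  have bound: "2 * (\<Sum>i<k. d i) \<le> f X" if X: "X \<in> Sp k n" for X
    using coords [OF X] f_S Sp_trace_bound(1) [where d = d and n = n and k = k, OF _ assms(5,6) pos mono] by fastforce
  obtain E where E: "E \<in> Sp k n" "mat_trace (E\<^sup>T * (double_diag n d * E)) = 2 * (\<Sum>i<k. d i)"
    using Sp_trace_attained [OF assms(6)] .
  have attained: "S * E \<in> Sp k n" "f (S * E) = 2 * (\<Sum>i<k. d i)"
    using Sp_mult [OF S E(1)] f_S [OF E(1)] E(2) by auto
  \<comment> \<open>The lower bound is attained, so minimality amounts to one equation for
    \<open>f X\<close>, and the rest of the proof works with that equation.\<close>
  have minimizer_iff: "global_minimizer k n M X \<longleftrightarrow> X \<in> Sp k n \<and> f X = 2 * (\<Sum>i<k. d i)" for X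
  proof
    assume "global_minimizer k n M X"
    then have X: "X \<in> Sp k n" "\<not> f (S * E) < f X"
      using attained(1) by (auto simp: global_minimizer_def is_arg_min_def f_def)
    then show "X \<in> Sp k n \<and> f X = 2 * (\<Sum>i<k. d i)" using bound [OF X(1)] attained(2) by simp
  next
    assume "X \<in> Sp k n \<and> f X = 2 * (\<Sum>i<k. d i)"
    then show "global_minimizer k n M X"
      using bound by (auto simp: global_minimizer_def is_arg_min_def f_def not_less)
  qed
  \<comment> \<open>Cyclicity of the trace cancels the orthogonal \<open>K\<close>. This gives (i),
    and in (ii) it carries the value at \<open>X * K\<close> back to \<open>X\<close>.\<close>
  have f_OrSp: "f (X * K) = f X" "X * K \<in> Sp k n" if X: "X \<in> Sp k n" and K: "K \<in> OrSp k" for X K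
  proof -
    have K': "K \<in> Sp k k" "K\<^sup>T * K = 1\<^sub>m (2 * k)" using K by (auto simp: OrSp_def)
    have [simp]: "dim_row X = 2 * n" "dim_col X = 2 * k" "dim_row K = 2 * k" "dim_col K = 2 * k"
      using Sp_carrier [OF X] Sp_carrier [OF K'(1)] by auto
    have KK: "K * K\<^sup>T = 1\<^sub>m (2 * k)"
      using mat_mult_left_right_inverse [of "K\<^sup>T" "2 * k" K] K'(2) Sp_carrier [OF K'(1)] by simp
    have "f (X * K) = mat_trace (K\<^sup>T * ((X\<^sup>T * M * X) * K))"
      by (simp add: f_def transpose_mult_dim mult_assoc_dim)
    also have "\<dots> = mat_trace (((X\<^sup>T * M * X) * K) * K\<^sup>T)" by (rule mat_trace_comm) auto
    also have "((X\<^sup>T * M * X) * K) * K\<^sup>T = (X\<^sup>T * M * X) * (K * K\<^sup>T)" by (rule mult_assoc_dim) auto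
    finally show "f (X * K) = f X" by (simp add: KK f_def)
    show "X * K \<in> Sp k n" by (rule Sp_mult [OF X K'(1)])
  qed
  have eigen_f: "f X = 2 * (\<Sum>i<k. d i)"
    if "normalized_symplectic_eigenvector_set k n M d X" for X
  proof -
    have X: "X \<in> Sp k n" and MX: "M * X = J_mat n * X * - (J_mat k * double_diag k d)"
      using that by (auto simp: normalized_symplectic_eigenvector_set_def eigenvector_block_eq)
    have [simp]: "dim_row X = 2 * n" "dim_col X = 2 * k" using Sp_carrier [OF X] by auto
    \<comment> \<open>Multiplying the eigenvector equation by \<open>X\<^sup>T\<close> lets the
      constraint reduce its right-hand side to \<open>double_diag k d\<close>.\<close>
    have "X\<^sup>T * M * X = X\<^sup>T * (M * X)" by (simp add: mult_assoc_dim)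
    also have "\<dots> = (X\<^sup>T * (J_mat n * X)) * - (J_mat k * double_diag k d)"
      by (simp add: MX mult_assoc_dim)
    also have "\<dots> = double_diag k d"
      by (simp add: Sp_eq [OF X] minus_mult_right_dim J_J_mult)
    finally show ?thesis by (simp add: f_def trace_double_diag)
  qed
  have minimizer_eigen: "\<exists>K \<in> OrSp k. normalized_symplectic_eigenvector_set k n M d (X * K)"
    if X: "X \<in> Sp k n" and fX: "f X = 2 * (\<Sum>i<k. d i)" for X
  proof -
    obtain Y where Y: "Y \<in> Sp k n" and XY: "X = S * Y" using coords [OF X] by blast
    obtain K where K: "K \<in> OrSp k" and JZ: "J_mat n * (Y * K) = (Y * K) * J_mat k"
      and DZ: "double_diag n d * (Y * K) = (Y * K) * double_diag k d"
      using Sp_trace_minimal_diagonalize [where d = d, OF Y assms(5,6) pos mono] f_S [OF Y] fX XY by metis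
    define Z where "Z = Y * K"
    have K': "K \<in> Sp k k" using K by (simp add: OrSp_def)
    have [simp]: "dim_row Y = 2 * n" "dim_col Y = 2 * k" "dim_row K = 2 * k" "dim_col K = 2 * k"
      using Sp_carrier [OF Y] Sp_carrier [OF K'] by auto
    have [simp]: "dim_row Z = 2 * n" "dim_col Z = 2 * k" by (simp_all add: Z_def)
    have XK: "X * K = S * Z" by (simp add: XY Z_def mult_assoc_dim)
    \<comment> \<open>The eigenvector equation in Williamson coordinates, assembled from
      \<open>JZ\<close> and \<open>DZ\<close>.\<close>
    have block: "J_mat n * (Z * - (J_mat k * double_diag k d)) = double_diag n d * Z"
    proof -
      have "Z * - (J_mat k * double_diag k d) = - ((Z * J_mat k) * double_diag k d)"
        by (simp add: minus_mult_right_dim mult_assoc_dim)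
      also have "Z * J_mat k = J_mat n * Z" using JZ by (simp add: Z_def)
      finally show ?thesis
        using DZ by (simp add: minus_mult_right_dim mult_assoc_dim J_J_mult Z_def [symmetric])
    qed
    \<comment> \<open>Inserting this identity matrix brings \<open>S\<^sup>T\<close> next to
      \<open>M\<close>, where \<open>SMS\<close> and \<open>block\<close> apply; symplecticity of
      \<open>S\<close> then allows the same identity to be removed again.\<close>
    have "M * (S * Z) = (R\<^sup>T * S\<^sup>T) * (M * (S * Z))" by (simp add: RTST)
    also have "\<dots> = R\<^sup>T * ((S\<^sup>T * (M * S)) * Z)" by (simp add: mult_assoc_dim)
    also have "\<dots> = R\<^sup>T * ((S\<^sup>T * (J_mat n * S)) * (Z * - (J_mat k * double_diag k d)))"
      by (simp only: SMS Sp_eq [OF S] block)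
    also have "\<dots> = (R\<^sup>T * S\<^sup>T) * (J_mat n * (S * Z) * - (J_mat k * double_diag k d))"
      by (simp add: mult_assoc_dim)
    also have "\<dots> = J_mat n * (S * Z) * - (J_mat k * double_diag k d)" by (simp add: RTST)
    finally have "normalized_symplectic_eigenvector_set k n M d (X * K)"
      using f_OrSp(2) [OF X K]
      by (simp add: normalized_symplectic_eigenvector_set_def eigenvector_block_eq XK)
    then show ?thesis using K by blast
  qed
  have eigen_minimizer: "f X = 2 * (\<Sum>i<k. d i)"
    if "X \<in> Sp k n" "K \<in> OrSp k" "normalized_symplectic_eigenvector_set k n M d (X * K)" for X K
    using eigen_f [OF that(3)] f_OrSp(1) [OF that(1,2)] by simp
  show ?thesis
    unfolding minimizer_iff using f_OrSp minimizer_eigen eigen_minimizer by metis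
qed

end
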